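(* Let $X$ be a real Banach space, let $\mathcal{U}$ be a free ultrafilter on $\mathbb{N}$, and let $\jmath\colon X\to X^{\mathcal{U}}$ be the canonical inclusion of $X$ into its ultrapower. Let $x\in S_X$. (1) The point $x$ is an MLUR point of $X$ if and only if $\jmath(x)$ is an extreme point of $B_{X^{\mathcal{U}}}$. (2) If $\jmath(x)\in S_{X^{\mathcal{U}}}$ is a Gâteaux smooth point, then $x\in S_X$ is a Fréchet smooth point. Moreover, if $X$ is superreflexive, then the converse also holds: if $x$ is a Fréchet smooth point, then $\jmath(x)$ is a Gâteaux smooth point of $S_{X^{\mathcal{U}}}$. In particular, for $x \in S_X$, whether $\jmath(x)$ is an extreme point of $B_{X^{\mathcal{U}}}$ does not depend on the particular choice of the free ultrafilter $\mathcal{U}$ on $\mathbb{N}$.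
   Context: $B_X$ and $S_X$ denote the closed unit ball and the unit sphere of $X$. The ultrapower is $X^{\mathcal{U}}=\ell^\infty(X)/N_{\mathcal{U}}$ with the quotient norm, where $N_{\mathcal{U}}=\{(x_n)\in\ell^\infty(X)\colon \lim_{n,\mathcal{U}}\|x_n\|=0\}$; the coset of $(x_n)$ is written $(x_n)^{\mathcal{U}}$, and $\|(x_n)^{\mathcal{U}}\|=\lim_{n,\mathcal{U}}\|x_n\|$. The canonical inclusion is $\jmath(x)=(x,x,x,\ldots)^{\mathcal{U}}$. A point $x\in S_X$ is an MLUR (midpoint locally uniformly rotund) point if for all sequences $(y_n),(z_n)\subset S_X$ with $\|\tfrac{y_n+z_n}{2}-x\|\to 0$ one has $\|y_n-z_n\|\to 0$. A point of the unit sphere is a Gâteaux (resp. Fréchet) smooth point if the norm is Gâteaux (resp. Fréchet) differentiable at that point. *)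

theory Defs
  imports "HOL-Analysis.Analysis"
begin

section \<open>Normed spaces on an explicit carrier\<close>

text \<open>The ultrapower depends on an ultrafilter, hence on a term, so it cannot be an instance of
  the class \<^class>\<open>banach\<close>; also the definition of superreflexivity quantifies over Banach spaces.
  For both purposes we use real normed spaces given by a record of operations.  The values of the
  operations outside the carrier are irrelevant.\<close>

record 'v nvs =
  carrier :: "'v set"
  zero :: 'v
  add :: "'v \<Rightarrow> 'v \<Rightarrow> 'v"
  smul :: "real \<Rightarrow> 'v \<Rightarrow> 'v"
  nrm :: "'v \<Rightarrow> real"

locale normed_vs =
  fixes V :: "'v nvs"
  assumes zero_closed: "zero V \<in> carrier V"
    and add_closed: "\<lbrakk>u \<in> carrier V; v \<in> carrier V\<rbrakk> \<Longrightarrow> add V u v \<in> carrier V"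
    and smul_closed: "u \<in> carrier V \<Longrightarrow> smul V r u \<in> carrier V"
    and add_assoc: "\<lbrakk>u \<in> carrier V; v \<in> carrier V; w \<in> carrier V\<rbrakk>
      \<Longrightarrow> add V (add V u v) w = add V u (add V v w)"
    and add_commute: "\<lbrakk>u \<in> carrier V; v \<in> carrier V\<rbrakk> \<Longrightarrow> add V u v = add V v u"
    and add_zero: "u \<in> carrier V \<Longrightarrow> add V u (zero V) = u"
    and add_inverse: "u \<in> carrier V \<Longrightarrow> \<exists>v\<in>carrier V. add V u v = zero V"
    and smul_add_right: "\<lbrakk>u \<in> carrier V; v \<in> carrier V\<rbrakk>
      \<Longrightarrow> smul V r (add V u v) = add V (smul V r u) (smul V r v)"
    and smul_add_left: "u \<in> carrier V \<Longrightarrow> smul V (r + s) u = add V (smul V r u) (smul V s u)"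
    and smul_smul: "u \<in> carrier V \<Longrightarrow> smul V r (smul V s u) = smul V (r * s) u"
    and smul_one: "u \<in> carrier V \<Longrightarrow> smul V 1 u = u"
    and nrm_nonneg: "u \<in> carrier V \<Longrightarrow> 0 \<le> nrm V u"
    and nrm_eq_zero: "u \<in> carrier V \<Longrightarrow> nrm V u = 0 \<longleftrightarrow> u = zero V"
    and nrm_smul: "u \<in> carrier V \<Longrightarrow> nrm V (smul V r u) = \<bar>r\<bar> * nrm V u"
    and nrm_triangle: "\<lbrakk>u \<in> carrier V; v \<in> carrier V\<rbrakk> \<Longrightarrow> nrm V (add V u v) \<le> nrm V u + nrm V v"

definition vdist :: "'v nvs \<Rightarrow> 'v \<Rightarrow> 'v \<Rightarrow> real" where
  "vdist V u v = nrm V (add V u (smul V (- 1) v))"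

locale banach_vs = normed_vs V for V :: "'v nvs" +
  assumes complete: "\<lbrakk>\<forall>n::nat. s n \<in> carrier V; \<forall>e>0. \<exists>N. \<forall>m\<ge>N. \<forall>n\<ge>N. vdist V (s m) (s n) < e\<rbrakk>
    \<Longrightarrow> \<exists>l\<in>carrier V. (\<lambda>n. vdist V (s n) l) \<longlonglongrightarrow> 0"

definition unit_ball :: "'v nvs \<Rightarrow> 'v set" where
  "unit_ball V = {u \<in> carrier V. nrm V u \<le> 1}"

definition unit_sphere :: "'v nvs \<Rightarrow> 'v set" where
  "unit_sphere V = {u \<in> carrier V. nrm V u = 1}"

text \<open>Carrier version of \<^const>\<open>extreme_point_of\<close>, with open segments written out.\<close>

definition extreme_point :: "'v nvs \<Rightarrow> 'v set \<Rightarrow> 'v \<Rightarrow> bool" where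
  "extreme_point V S u \<longleftrightarrow> u \<in> S \<and>
     (\<forall>a\<in>S. \<forall>b\<in>S. \<not> (a \<noteq> b \<and>
        (\<exists>t. 0 < t \<and> t < 1 \<and> u = add V (smul V (1 - t) a) (smul V t b))))"

definition linear_map_on :: "'v nvs \<Rightarrow> 'v set \<Rightarrow> ('v \<Rightarrow> 'a::real_vector) \<Rightarrow> bool" where
  "linear_map_on V E T \<longleftrightarrow>
     (\<forall>u\<in>E. \<forall>v\<in>E. T (add V u v) = T u + T v) \<and> (\<forall>u\<in>E. \<forall>r. T (smul V r u) = r *\<^sub>R T u)"

text \<open>Bounded linear functionals are normalised to be 0 outside the carrier, so that equality in
  the dual space is equality of functions.\<close>

definition dual_space :: "'v nvs \<Rightarrow> ('v \<Rightarrow> real) nvs" where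
  "dual_space V = \<lparr>
     carrier = {f. linear_map_on V (carrier V) f \<and>
                   (\<exists>K. \<forall>u\<in>carrier V. \<bar>f u\<bar> \<le> K * nrm V u) \<and>
                   (\<forall>u. u \<notin> carrier V \<longrightarrow> f u = 0)},
     zero = (\<lambda>u. 0),
     add = (\<lambda>f g u. f u + g u),
     smul = (\<lambda>r f u. r * f u),
     nrm = (\<lambda>f. SUP u\<in>unit_ball V. \<bar>f u\<bar>)\<rparr>"

definition reflexive :: "'v nvs \<Rightarrow> bool" where
  "reflexive V \<longleftrightarrow> (\<forall>\<phi>\<in>carrier (dual_space (dual_space V)).
     \<exists>u\<in>carrier V. \<forall>f\<in>carrier (dual_space V). \<phi> f = f u)"

definition gateaux_smooth_point :: "'v nvs \<Rightarrow> 'v \<Rightarrow> bool" where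
  "gateaux_smooth_point V u \<longleftrightarrow> u \<in> unit_sphere V \<and>
     (\<exists>f\<in>carrier (dual_space V). \<forall>h\<in>carrier V.
        ((\<lambda>t. (nrm V (add V u (smul V t h)) - nrm V u) / t) \<longlongrightarrow> f h) (at 0))"

section \<open>Superreflexivity\<close>

definition vsubspace :: "'v nvs \<Rightarrow> 'v set \<Rightarrow> bool" where
  "vsubspace V E \<longleftrightarrow> E \<subseteq> carrier V \<and> zero V \<in> E \<and>
     (\<forall>u\<in>E. \<forall>v\<in>E. add V u v \<in> E) \<and> (\<forall>u\<in>E. \<forall>r. smul V r u \<in> E)"

definition finite_dim_subspace :: "'v nvs \<Rightarrow> 'v set \<Rightarrow> bool" where
  "finite_dim_subspace V E \<longleftrightarrow>
     (\<exists>B. finite B \<and> B \<subseteq> carrier V \<and> E = \<Inter>{F. vsubspace V F \<and> B \<subseteq> F})"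

text \<open>Every finite-dimensional subspace of \<open>V\<close> is \<open>(1 + \<epsilon>)\<close>-isomorphic to a subspace
  of the Banach space \<open>'a\<close>, namely the range of \<open>T\<close>.  The isomorphism is scaled so that its
  inverse has norm at most 1.\<close>

definition finitely_representable :: "'v nvs \<Rightarrow> 'a::real_normed_vector itself \<Rightarrow> bool" where
  "finitely_representable V A \<longleftrightarrow>
     (\<forall>E. finite_dim_subspace V E \<longrightarrow> (\<forall>\<epsilon>>0. \<exists>T :: 'v \<Rightarrow> 'a. linear_map_on V E T \<and>
        (\<forall>u\<in>E. nrm V u \<le> norm (T u) \<and> norm (T u) \<le> (1 + \<epsilon>) * nrm V u)))"

text \<open>James' definition: all Banach spaces finitely representable in \<open>'a\<close> are reflexive.  HOL
  cannot quantify over types, so the spaces \<open>Y\<close> range over all Banach spaces whose underlying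
  set is a subset of one fixed type.  This loses nothing.  A Banach space is reflexive iff its
  separable closed subspaces are, and finite representability passes to subspaces, so separable
  \<open>Y\<close> suffice; these have at most the cardinality of the continuum, and hence have isometric
  copies on subsets of the type used here unless \<open>'a\<close> is the zero space (in which
  case every \<open>Y\<close> finitely representable in it is zero).\<close>

definition superreflexive :: "'a::banach itself \<Rightarrow> bool" where
  "superreflexive A \<longleftrightarrow>
     (\<forall>Y :: (nat \<Rightarrow>\<^sub>C 'a) set nvs. banach_vs Y \<and> finitely_representable Y A \<longrightarrow> reflexive Y)"

section \<open>Ultrapowers\<close>

text \<open>Same formulation as in the distribution's nonstandard analysis library.\<close>

definition free_ultrafilter :: "nat filter \<Rightarrow> bool" where
  "free_ultrafilter U \<longleftrightarrow> U \<noteq> bot \<and>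
     (\<forall>P. eventually P U \<or> eventually (\<lambda>n. \<not> P n) U) \<and>
     (\<forall>P. eventually P U \<longrightarrow> infinite {n. P n})"

text \<open>As \<^typ>\<open>nat\<close> carries the discrete topology, \<^typ>\<open>nat \<Rightarrow>\<^sub>C 'a\<close> is the space
  \<open>\<ell>\<^sup>\<infinity>\<close> of all bounded sequences with the supremum norm.\<close>

definition null_seqs :: "nat filter \<Rightarrow> (nat \<Rightarrow>\<^sub>C 'a::real_normed_vector) set" where
  "null_seqs U = {s. ((\<lambda>n. norm (apply_bcontfun s n)) \<longlongrightarrow> 0) U}"

definition ucoset :: "nat filter \<Rightarrow> (nat \<Rightarrow>\<^sub>C 'a::real_normed_vector) \<Rightarrow> (nat \<Rightarrow>\<^sub>C 'a) set" where
  "ucoset U s = {s + z | z. z \<in> null_seqs U}"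

text \<open>In the scalar multiplication the summand \<open>z\<close> only matters for \<open>r = 0\<close>.\<close>

definition ultrapower :: "nat filter \<Rightarrow> (nat \<Rightarrow>\<^sub>C 'a::real_normed_vector) set nvs" where
  "ultrapower U = \<lparr>
     carrier = range (ucoset U),
     zero = null_seqs U,
     add = (\<lambda>C D. {c + d | c d. c \<in> C \<and> d \<in> D}),
     smul = (\<lambda>r C. {r *\<^sub>R c + z | c z. c \<in> C \<and> z \<in> null_seqs U}),
     nrm = (\<lambda>C. INF c\<in>C. norm c)\<rparr>"

definition canonical_incl :: "nat filter \<Rightarrow> 'a::real_normed_vector \<Rightarrow> (nat \<Rightarrow>\<^sub>C 'a) set" where
  "canonical_incl U x = ucoset U (const_bcontfun x)"

section \<open>Points of the unit sphere of a Banach space\<close>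

definition mlur_point :: "'a::real_normed_vector \<Rightarrow> bool" where
  "mlur_point x \<longleftrightarrow> x \<in> sphere 0 1 \<and>
     (\<forall>y z :: nat \<Rightarrow> 'a. range y \<subseteq> sphere 0 1 \<and> range z \<subseteq> sphere 0 1 \<and>
        (\<lambda>n. norm (midpoint (y n) (z n) - x)) \<longlonglongrightarrow> 0 \<longrightarrow> (\<lambda>n. norm (y n - z n)) \<longlonglongrightarrow> 0)"

text \<open>\<^const>\<open>differentiable\<close> is Frechet differentiability.\<close>

definition frechet_smooth_point :: "'a::real_normed_vector \<Rightarrow> bool" where
  "frechet_smooth_point x \<longleftrightarrow> x \<in> sphere 0 1 \<and> (norm :: 'a \<Rightarrow> real) differentiable (at x)"

end

theory Submission
  imports Defs
begin

text \<open>The norm of a class in the ultrapower is the limit of the norms of any representative, so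
  all statements become statements about sequences.  For (1), a proper segment in
  \<open>B\<^bsub>X\<^sup>U\<^esub>\<close> through \<open>\<jmath>(x)\<close> can be shortened to one with midpoint
  \<open>\<jmath>(x)\<close>; its representatives violate the \<open>\<epsilon>\<close>-\<open>\<delta>\<close> form of MLUR, and conversely.
  For (2), if Frechet differentiability fails along \<open>h\<^sub>n \<rightarrow> 0\<close>, then convexity shows that
  Gateaux differentiability at \<open>\<jmath>(x)\<close> fails in the direction of the class of
  \<open>h\<^sub>n / \<parallel>h\<^sub>n\<parallel>\<close>.  Conversely, the Frechet derivative estimate is uniform over bounded
  sequences of directions and so passes to the limit along \<open>U\<close>.\<close>

section \<open>Limits along ultrafilters\<close>

lemma free_ultrafilter_neq_bot: "free_ultrafilter U \<Longrightarrow> U \<noteq> bot"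
  by (simp add: free_ultrafilter_def)

text \<open>If a cofinite set were missing from \<open>U\<close>, its finite complement would belong
  to \<open>U\<close>, against freeness. Hence ordinary limits of sequences are also limits along
  \<open>U\<close>.\<close>

lemma free_ultrafilter_le_sequentially:
  assumes "free_ultrafilter U"
  shows "U \<le> sequentially"
proof (rule filter_leI)
  fix P :: "nat \<Rightarrow> bool"
  assume "eventually P sequentially"
  then have "finite {n. \<not> P n}"
    by (simp add: cofinite_eq_sequentially[symmetric] eventually_cofinite)
  then show "eventually P U"
    using assms unfolding free_ultrafilter_def by blast
qed

text \<open>The image filter of \<open>U\<close> under \<open>f\<close> lives on a compact set and
  so has a cluster point \<open>l\<close>. For an ultrafilter a cluster point is a limit: if a
  neighbourhood of \<open>l\<close> did not belong to the image filter, its complement would, and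
  \<open>l\<close> would not be a cluster point.\<close>

lemma free_ultrafilter_bounded_convergent:
  fixes f :: "nat \<Rightarrow> real"
  assumes U: "free_ultrafilter U" and "bounded (range f)"
  obtains l where "(f \<longlongrightarrow> l) U"
proof -
  define F where "F = filtermap f U"
  have "compact (closure (range f))"
    using assms(2) by simp
  moreover have "F \<noteq> bot"
    using U by (simp add: F_def filtermap_bot_iff free_ultrafilter_def)
  moreover have "eventually (\<lambda>y. y \<in> closure (range f)) F"
    unfolding F_def eventually_filtermap
    by (intro always_eventually) (use closure_subset in fastforce)
  ultimately obtain l where l: "inf (nhds l) F \<noteq> bot"
    unfolding compact_filter by blast
  have "F \<le> nhds l"
  proof (rule filter_leI)
    fix P assume P: "eventually P (nhds l)"
    have "eventually (\<lambda>n. P (f n)) U \<or> eventually (\<lambda>n. \<not> P (f n)) U"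
      using U by (simp add: free_ultrafilter_def)
    then show "eventually P F"
    proof
      assume "eventually (\<lambda>n. \<not> P (f n)) U"
      then have "eventually (\<lambda>y. \<not> P y) F"
        by (simp add: F_def eventually_filtermap)
      with P have "eventually (\<lambda>y. False) (inf (nhds l) F)"
        unfolding eventually_inf by blast
      with l show ?thesis by (simp add: trivial_limit_def)
    qed (simp add: F_def eventually_filtermap)
  qed
  then show ?thesis
    using that by (simp add: F_def filterlim_def)
qed

section \<open>Calculus in the ultrapower\<close>

lemma apply_bcontfun_Bcontfun:
  fixes f :: "nat \<Rightarrow> 'a::real_normed_vector"
  assumes "\<And>n. norm (f n) \<le> b"
  shows "apply_bcontfun (Bcontfun f) = f"
  by (rule Bcontfun_inverse[OF bcontfun_normI[where b=b]])
    (use assms in \<open>simp_all add: continuous_on_discrete\<close>)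

lemma bounded_range_apply_bcontfun:
  fixes s :: "nat \<Rightarrow>\<^sub>C 'a::real_normed_vector"
  shows "bounded (range (apply_bcontfun s))"
  using apply_bcontfun[of s] by (simp add: bcontfun_def)

lemma norm_tendsto_exists:
  fixes s :: "nat \<Rightarrow>\<^sub>C 'a::real_normed_vector"
  assumes "free_ultrafilter U"
  obtains l where "((\<lambda>n. norm (s n)) \<longlongrightarrow> l) U"
proof (rule free_ultrafilter_bounded_convergent[OF assms])
  show "bounded (range (\<lambda>n. norm (s n)))"
    unfolding bounded_iff by (intro exI[of _ "norm s"]) (auto intro: norm_bounded)
qed

section \<open>Null sequences and their cosets\<close>

lemma null_seqs_iff: "z \<in> null_seqs U \<longleftrightarrow> ((\<lambda>n. apply_bcontfun z n) \<longlongrightarrow> 0) U"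
  by (simp add: null_seqs_def tendsto_norm_zero_iff)

lemma zero_null_seqs: "0 \<in> null_seqs U"
  by (simp add: null_seqs_iff)

lemma add_null_seqs: "y \<in> null_seqs U \<Longrightarrow> z \<in> null_seqs U \<Longrightarrow> y + z \<in> null_seqs U"
  unfolding null_seqs_iff by (simp add: tendsto_add_zero)

lemma scaleR_null_seqs: "z \<in> null_seqs U \<Longrightarrow> r *\<^sub>R z \<in> null_seqs U"
  unfolding null_seqs_iff using tendsto_scaleR[OF tendsto_const[of r]] by fastforce

lemma mem_ucoset_iff: "c \<in> ucoset U s \<longleftrightarrow> c - s \<in> null_seqs U"
  unfolding ucoset_def by (auto intro!: exI[of _ "c - s"])

lemma mem_ucoset_self: "s \<in> ucoset U s"
  by (simp add: mem_ucoset_iff zero_null_seqs)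

lemma ucoset_eq_iff: "ucoset U s = ucoset U t \<longleftrightarrow> s - t \<in> null_seqs U"
proof
  assume "ucoset U s = ucoset U t"
  then show "s - t \<in> null_seqs U"
    using mem_ucoset_self[of s U] by (simp add: mem_ucoset_iff)
next
  assume st: "s - t \<in> null_seqs U"
  have "c - s \<in> null_seqs U \<longleftrightarrow> c - t \<in> null_seqs U" for c
    using add_null_seqs[OF _ st, of "c - s"]
      add_null_seqs[OF _ scaleR_null_seqs[OF st, of "-1"], of "c - t"] by auto
  then show "ucoset U s = ucoset U t"
    by (auto simp: mem_ucoset_iff)
qed

lemma ucoset_eq_iff_tendsto:
  "ucoset U s = ucoset U t \<longleftrightarrow> ((\<lambda>n. norm (s n - t n)) \<longlongrightarrow> 0) U"
  by (simp add: ucoset_eq_iff null_seqs_def)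

section \<open>Operations and norm of the ultrapower in terms of representatives\<close>

lemma carrier_ultrapower: "carrier (ultrapower U) = range (ucoset U)"
  by (simp add: ultrapower_def)

lemma add_ultrapower: "add (ultrapower U) (ucoset U s) (ucoset U t) = ucoset U (s + t)"
proof -
  have "\<exists>c d. e = c + d \<and> c \<in> ucoset U s \<and> d \<in> ucoset U t" if "e \<in> ucoset U (s + t)" for e
    using that mem_ucoset_self[of t U]
    by (intro exI[of _ "e - t"] exI[of _ t]) (simp add: mem_ucoset_iff diff_diff_eq add.commute)
  moreover have "c + d \<in> ucoset U (s + t)" if "c \<in> ucoset U s" "d \<in> ucoset U t" for c d
    using add_null_seqs[of "c - s" U "d - t"] that
    by (simp add: mem_ucoset_iff algebra_simps)
  ultimately show ?thesis
    unfolding ultrapower_def by auto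
qed

lemma smul_ultrapower: "smul (ultrapower U) r (ucoset U s) = ucoset U (r *\<^sub>R s)"
proof -
  have "\<exists>c z. e = r *\<^sub>R c + z \<and> c \<in> ucoset U s \<and> z \<in> null_seqs U"
    if "e \<in> ucoset U (r *\<^sub>R s)" for e
    using that mem_ucoset_self[of s U]
    by (intro exI[of _ s] exI[of _ "e - r *\<^sub>R s"]) (simp add: mem_ucoset_iff)
  moreover have "r *\<^sub>R c + z \<in> ucoset U (r *\<^sub>R s)"
    if "c \<in> ucoset U s" "z \<in> null_seqs U" for c z
    using add_null_seqs[OF scaleR_null_seqs[of "c - s" U r], of z] that
    by (simp add: mem_ucoset_iff algebra_simps)
  ultimately show ?thesis
    unfolding ultrapower_def by auto
qed

text \<open>A representative differs from \<open>s\<close> by a null sequence, so its supremum norm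
  is at least \<open>l\<close>. Conversely, suitable truncations of \<open>s\<close> are
  representatives with supremum norm at most \<open>l + e\<close>, for every
  \<open>e > 0\<close>.\<close>

lemma nrm_ultrapower:
  fixes s :: "nat \<Rightarrow>\<^sub>C 'a::real_normed_vector"
  assumes "U \<noteq> bot" and lim: "((\<lambda>n. norm (s n)) \<longlongrightarrow> l) U"
  shows "nrm (ultrapower U) (ucoset U s) = l"
proof -
  have lower: "l \<le> norm c" if "c \<in> ucoset U s" for c
  proof (rule tendsto_upperbound[OF _ _ assms(1)])
    have "((\<lambda>n. (c - s) n) \<longlongrightarrow> 0) U"
      using that by (simp only: mem_ucoset_iff null_seqs_iff)
    from tendsto_norm[OF this] have "((\<lambda>n. norm (c n - s n)) \<longlongrightarrow> 0) U"
      by simp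
    from tendsto_diff[OF lim this] show "((\<lambda>n. norm (s n) - norm (c n - s n)) \<longlongrightarrow> l) U"
      by simp
    show "\<forall>\<^sub>F n in U. norm (s n) - norm (c n - s n) \<le> norm c"
    proof (intro always_eventually allI)
      fix n
      have "norm (s n) \<le> norm (c n) + norm (c n - s n)"
        by (metis norm_minus_commute norm_triangle_sub)
      then show "norm (s n) - norm (c n - s n) \<le> norm c"
        using norm_bounded[of c n] by linarith
    qed
  qed
  have "0 \<le> l"
    by (rule tendsto_lowerbound[OF lim _ assms(1)]) simp
  have upper: "(INF c\<in>ucoset U s. norm c) \<le> l + e" if "e > 0" for e
  proof -
    \<comment> \<open>Terms of norm at least \<open>l + e\<close> are set to zero. They occur only
      off a set of \<open>U\<close>, so the coset does not change.\<close>
    define c where "c = Bcontfun (\<lambda>n. if norm (s n) < l + e then s n else 0)"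
    have c: "c n = (if norm (s n) < l + e then s n else 0)" for n
      unfolding c_def
      by (subst apply_bcontfun_Bcontfun[where b="l + e"]) (use \<open>0 \<le> l\<close> that in auto)
    have "\<forall>\<^sub>F n in U. norm (s n) < l + e"
      using order_tendstoD(2)[OF lim, of "l + e"] that by simp
    then have "\<forall>\<^sub>F n in U. (c - s) n = 0"
      by eventually_elim (simp add: c)
    then have "c \<in> ucoset U s"
      unfolding mem_ucoset_iff null_seqs_iff by (rule tendsto_eventually)
    then have "(INF c\<in>ucoset U s. norm c) \<le> norm c"
      by (intro cINF_lower bdd_belowI2[of _ 0]) auto
    also have "norm c \<le> l + e"
      by (rule norm_bound) (use \<open>0 \<le> l\<close> that in \<open>auto simp: c\<close>)
    finally show ?thesis .
  qed
  have "(INF c\<in>ucoset U s. norm c) = l"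
  proof (rule antisym)
    show "(INF c\<in>ucoset U s. norm c) \<le> l"
      by (rule field_le_epsilon) (rule upper)
    show "l \<le> (INF c\<in>ucoset U s. norm c)"
      by (rule cINF_greatest) (use mem_ucoset_self in \<open>auto intro: lower\<close>)
  qed
  then show ?thesis
    by (simp add: ultrapower_def)
qed

lemma tendsto_nrm_ultrapower:
  fixes s :: "nat \<Rightarrow>\<^sub>C 'a::real_normed_vector"
  assumes "free_ultrafilter U"
  shows "((\<lambda>n. norm (s n)) \<longlongrightarrow> nrm (ultrapower U) (ucoset U s)) U"
  using norm_tendsto_exists[OF assms, of s] nrm_ultrapower[OF free_ultrafilter_neq_bot[OF assms]]
  by metis

lemma nrm_canonical_incl:
  "free_ultrafilter U \<Longrightarrow> nrm (ultrapower U) (canonical_incl U x) = norm x"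
  unfolding canonical_incl_def
  by (rule nrm_ultrapower) (simp_all add: free_ultrafilter_neq_bot const_bcontfun.rep_eq)

text \<open>The difference quotients of the norm at the canonical image of \<open>x\<close> are thus
  limits along \<open>U\<close> of difference quotients at \<open>x\<close>, for each fixed
  \<open>t\<close>. Both directions of the smoothness statement rest on this.\<close>

lemma tendsto_nrm_translate:
  fixes x :: "'a::real_normed_vector"
  assumes "free_ultrafilter U"
  shows "((\<lambda>n. norm (x + t *\<^sub>R apply_bcontfun s n)) \<longlongrightarrow>
      nrm (ultrapower U) (add (ultrapower U) (canonical_incl U x)
        (smul (ultrapower U) t (ucoset U s)))) U"
  using tendsto_nrm_ultrapower[OF assms, of "const_bcontfun x + t *\<^sub>R s"]
  by (simp add: canonical_incl_def add_ultrapower smul_ultrapower const_bcontfun.rep_eq)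

section \<open>MLUR points\<close>

lemma norm_sgn_diff:
  fixes y :: "'a::real_normed_vector"
  assumes "y \<noteq> 0"
  shows "norm (y - sgn y) = \<bar>norm y - 1\<bar>"
proof -
  have "y - sgn y = (norm y - 1) *\<^sub>R sgn y"
    using assms by (simp add: sgn_div_norm algebra_simps)
  then show ?thesis
    using assms by (simp add: norm_sgn)
qed

text \<open>Representatives of points of the unit ball of the ultrapower have terms of norm only
  nearly at most 1, so a form of MLUR is wanted that tolerates this. For a sequence of
  counterexamples, the midpoints near the unit vector \<open>x\<close> force the norms towards 1,
  and normalising yields sequences on the sphere that contradict MLUR.\<close>

lemma mlur_point_epsilon_delta:
  fixes x :: "'a::real_normed_vector"
  assumes "mlur_point x" and "e > 0"
  shows "\<exists>d>0. \<forall>y z. norm y \<le> 1 + d \<longrightarrow> norm z \<le> 1 + d \<longrightarrow> norm (midpoint y z - x) < d \<longrightarrow>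
    norm (y - z) < e"
proof (rule ccontr)
  assume neg: "\<not> ?thesis"
  \<comment> \<open>The shift by 4 gives \<open>4 * d n\<close> at most 1, which keeps the lower
    bound \<open>1 - 3 * d n\<close> for the norms of \<open>y n\<close> and \<open>z n\<close>
    positive.\<close>
  define d where "d = (\<lambda>n. 1 / (real n + 4))"
  have d: "d n > 0" "4 * d n \<le> 1" for n
    by (auto simp: d_def field_simps)
  have dlim: "d \<longlonglongrightarrow> 0"
    unfolding d_def by real_asymp
  have "\<forall>n. \<exists>y z. norm y \<le> 1 + d n \<and> norm z \<le> 1 + d n \<and> norm (midpoint y z - x) < d n \<and>
      e \<le> norm (y - z)"
    using neg d(1) by (metis not_le)
  then obtain y z where y: "\<And>n. norm (y n) \<le> 1 + d n" and z: "\<And>n. norm (z n) \<le> 1 + d n"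
    and m: "\<And>n. norm (midpoint (y n) (z n) - x) < d n" and yz: "\<And>n. e \<le> norm (y n - z n)"
    by metis
  have x1: "norm x = 1"
    using assms(1) by (simp add: mlur_point_def)
  have sum: "norm (y n) + norm (z n) \<ge> 2 - 2 * d n" for n
  proof -
    have "2 *\<^sub>R x = y n + z n - 2 *\<^sub>R (midpoint (y n) (z n) - x)"
      by (simp add: midpoint_def algebra_simps)
    then have "2 * norm x \<le> norm (y n + z n) + 2 * norm (midpoint (y n) (z n) - x)"
      by (metis norm_scaleR norm_triangle_ineq4 abs_numeral)
    then show ?thesis
      using norm_triangle_ineq[of "y n" "z n"] m[of n] x1 by linarith
  qed
  have "0 < norm (y n)" "0 < norm (z n)" for n
    using sum[of n] y[of n] z[of n] d[of n] by linarith+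
  then have nz: "y n \<noteq> 0" "z n \<noteq> 0" for n
    by simp_all
  \<comment> \<open>The norm of \<open>y n\<close> lies between \<open>1 - 3 * d n\<close> and
    \<open>1 + d n\<close>: the lower bound comes from \<open>sum\<close> and the upper bound on the
    norm of \<open>z n\<close>.\<close>
  have ys: "norm (y n - sgn (y n)) \<le> 3 * d n" for n
    unfolding norm_sgn_diff[OF nz(1)] using sum[of n] y[of n] z[of n] d(1)[of n] by linarith
  have zs: "norm (z n - sgn (z n)) \<le> 3 * d n" for n
    unfolding norm_sgn_diff[OF nz(2)] using sum[of n] y[of n] z[of n] d(1)[of n] by linarith
  have "norm (midpoint (sgn (y n)) (sgn (z n)) - x) \<le> 4 * d n" for n
  proof -
    have "midpoint (sgn (y n)) (sgn (z n)) - x = (midpoint (y n) (z n) - x)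
        - ((1/2) *\<^sub>R (y n - sgn (y n)) + (1/2) *\<^sub>R (z n - sgn (z n)))"
      by (simp add: midpoint_def algebra_simps)
    then have "norm (midpoint (sgn (y n)) (sgn (z n)) - x) \<le> norm (midpoint (y n) (z n) - x)
        + norm ((1/2) *\<^sub>R (y n - sgn (y n)) + (1/2) *\<^sub>R (z n - sgn (z n)))"
      by (metis norm_triangle_ineq4)
    also have "\<dots> \<le> d n + (1/2 * norm (y n - sgn (y n)) + 1/2 * norm (z n - sgn (z n)))"
    proof (rule add_mono[OF less_imp_le[OF m] norm_triangle_le])
      show "norm ((1/2) *\<^sub>R (y n - sgn (y n))) + norm ((1/2) *\<^sub>R (z n - sgn (z n)))
          \<le> 1/2 * norm (y n - sgn (y n)) + 1/2 * norm (z n - sgn (z n))"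
        unfolding norm_scaleR by simp
    qed
    finally show ?thesis
      using ys[of n] zs[of n] by linarith
  qed
  then have "(\<lambda>n. norm (midpoint (sgn (y n)) (sgn (z n)) - x)) \<longlonglongrightarrow> 0"
    by (intro Lim_null_comparison[OF _ tendsto_mult_right_zero[OF dlim, of 4]]) simp
  then have "(\<lambda>n. norm (sgn (y n) - sgn (z n))) \<longlonglongrightarrow> 0"
    using assms(1) nz unfolding mlur_point_def
    by (elim conjE allE[of _ "\<lambda>n. sgn (y n)"] allE[of _ "\<lambda>n. sgn (z n)"]) (auto simp: norm_sgn)
  \<comment> \<open>The term \<open>6 * d n\<close> pays for undoing both normalisations, each of
    which costs at most \<open>3 * d n\<close>.\<close>
  then have "(\<lambda>n. norm (sgn (y n) - sgn (z n)) + 6 * d n) \<longlonglongrightarrow> 0"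
    using tendsto_add_zero tendsto_mult_right_zero[OF dlim] by blast
  then have "\<forall>\<^sub>F n in sequentially. norm (sgn (y n) - sgn (z n)) + 6 * d n < e"
    using \<open>e > 0\<close> by (rule order_tendstoD)
  then obtain n where "norm (sgn (y n) - sgn (z n)) + 6 * d n < e"
    using eventually_happens'[OF sequentially_bot] by blast
  moreover have "norm (y n - z n) \<le> norm (y n - sgn (y n)) + norm (sgn (y n) - sgn (z n))
      + norm (z n - sgn (z n))"
    using norm_triangle_ineq4[of "y n - sgn (y n) + (sgn (y n) - sgn (z n))" "z n - sgn (z n)"]
      norm_triangle_ineq[of "y n - sgn (y n)" "sgn (y n) - sgn (z n)"] by simp
  ultimately show False
    using yz[of n] ys[of n] zs[of n] by linarith
qed

text \<open>MLUR speaks of midpoints only. A point dividing a segment in the ratio given by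
  \<open>t \<le> 1/2\<close> is the midpoint of a shorter segment with the same endpoint
  \<open>a n\<close>, whose length is \<open>2 * t\<close> times the original one. Hence the choice
  of \<open>2 * t * e\<close> as tolerance.\<close>

lemma mlur_point_segment_tendsto:
  fixes x :: "'a::real_normed_vector"
  assumes "mlur_point x" and t: "0 < t" "t \<le> 1/2"
    and a: "\<And>d. d > 0 \<Longrightarrow> \<forall>\<^sub>F n in F. norm (a n) \<le> 1 + d"
    and b: "\<And>d. d > 0 \<Longrightarrow> \<forall>\<^sub>F n in F. norm (b n) \<le> 1 + d"
    and lim: "((\<lambda>n. norm (x - ((1 - t) *\<^sub>R a n + t *\<^sub>R b n))) \<longlongrightarrow> 0) F"
  shows "((\<lambda>n. norm (a n - b n)) \<longlongrightarrow> 0) F"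
proof (rule tendstoI)
  fix e :: real assume "e > 0"
  then obtain d where "d > 0" and d: "\<And>y z. norm y \<le> 1 + d \<Longrightarrow> norm z \<le> 1 + d \<Longrightarrow>
      norm (midpoint y z - x) < d \<Longrightarrow> norm (y - z) < 2 * t * e"
    using mlur_point_epsilon_delta[OF assms(1), of "2 * t * e"] t by auto
  have "\<forall>\<^sub>F n in F. norm (x - ((1 - t) *\<^sub>R a n + t *\<^sub>R b n)) < d"
    using lim \<open>d > 0\<close> by (rule order_tendstoD)
  with a[OF \<open>d > 0\<close>] b[OF \<open>d > 0\<close>] show "\<forall>\<^sub>F n in F. dist (norm (a n - b n)) 0 < e"
  proof eventually_elim
    case (elim n)
    \<comment> \<open>The reflection of \<open>a n\<close> in the dividing point. It stays on the
      segment because \<open>2 * t\<close> is at most 1, so convexity bounds its norm.\<close>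
    let ?z = "(1 - 2 * t) *\<^sub>R a n + (2 * t) *\<^sub>R b n"
    have "norm ?z \<le> (1 - 2 * t) * norm (a n) + 2 * t * norm (b n)"
      using t by (intro norm_triangle_le) simp
    also have "\<dots> \<le> 1 + d"
      using elim t by (intro convex_bound_le) auto
    finally have "norm ?z \<le> 1 + d" .
    moreover have "midpoint (a n) ?z = (1 - t) *\<^sub>R a n + t *\<^sub>R b n"
    proof -
      have "midpoint (a n) ?z = (1/2 + (1/2) * (1 - 2 * t)) *\<^sub>R a n + ((1/2) * (2 * t)) *\<^sub>R b n"
        by (simp only: midpoint_def scaleR_add_right scaleR_add_left scaleR_scaleR add.assoc
            inverse_eq_divide)
      moreover have "1/2 + (1/2) * (1 - 2 * t) = 1 - t" "(1/2) * (2 * t) = t"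
        by (simp_all add: field_simps)
      ultimately show ?thesis by simp
    qed
    ultimately have "norm (a n - ?z) < 2 * t * e"
      using elim by (intro d) (auto simp: norm_minus_commute)
    moreover have "a n - ?z = (2 * t) *\<^sub>R (a n - b n)"
      by (simp add: algebra_simps)
    ultimately show ?case
      using t by simp
  qed
qed

section \<open>Extreme points of the unit ball of the ultrapower\<close>

lemma eventually_norm_le_of_mem_unit_ball:
  fixes s :: "nat \<Rightarrow>\<^sub>C 'a::real_normed_vector"
  assumes "free_ultrafilter U" and "ucoset U s \<in> unit_ball (ultrapower U)" and "d > 0"
  shows "\<forall>\<^sub>F n in U. norm (s n) \<le> 1 + d"
proof -
  have "nrm (ultrapower U) (ucoset U s) < 1 + d"
    using assms(2,3) by (simp add: unit_ball_def)
  from order_tendstoD(2)[OF tendsto_nrm_ultrapower[OF assms(1)] this] show ?thesis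
    by eventually_elim simp
qed

lemma extreme_point_canonical_incl_of_mlur:
  fixes x :: "'a::real_normed_vector"
  assumes U: "free_ultrafilter U" and x: "mlur_point x"
  shows "extreme_point (ultrapower U) (unit_ball (ultrapower U)) (canonical_incl U x)"
  unfolding extreme_point_def
proof (intro conjI ballI notI)
  let ?W = "ultrapower U :: (nat \<Rightarrow>\<^sub>C 'a) set nvs"
  show "canonical_incl U x \<in> unit_ball ?W"
    using x nrm_canonical_incl[OF U, of x]
    by (simp add: unit_ball_def carrier_ultrapower mlur_point_def) (simp add: canonical_incl_def)
  fix A B
  assume AB: "A \<in> unit_ball ?W" "B \<in> unit_ball ?W"
    and "A \<noteq> B \<and> (\<exists>t. 0 < t \<and> t < 1 \<and>
      canonical_incl U x = add ?W (smul ?W (1 - t) A) (smul ?W t B))"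
  then obtain t where "A \<noteq> B" and t: "0 < t" "t < 1"
    and eq: "canonical_incl U x = add ?W (smul ?W (1 - t) A) (smul ?W t B)"
    by blast
  obtain a b where a: "A = ucoset U a" and b: "B = ucoset U b"
    using AB by (auto simp: unit_ball_def carrier_ultrapower)
  have lim: "((\<lambda>n. norm (x - ((1 - t) *\<^sub>R a n + t *\<^sub>R b n))) \<longlongrightarrow> 0) U"
    using eq by (simp add: canonical_incl_def a b add_ultrapower smul_ultrapower
        ucoset_eq_iff_tendsto const_bcontfun.rep_eq)
  note bounds = eventually_norm_le_of_mem_unit_ball[OF U AB(1)[unfolded a]]
    eventually_norm_le_of_mem_unit_ball[OF U AB(2)[unfolded b]]
  have "((\<lambda>n. norm (a n - b n)) \<longlongrightarrow> 0) U"
  \<comment> \<open>Exchanging the endpoints replaces \<open>t\<close> by \<open>1 - t\<close>, so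
    one of the two orders meets the bound 1/2.\<close>
  proof (cases "t \<le> 1/2")
    case True
    then show ?thesis
      using mlur_point_segment_tendsto[OF x t(1) _ bounds lim] by simp
  next
    case False
    then show ?thesis
      using mlur_point_segment_tendsto[OF x _ _ bounds(2,1), of "1 - t"] lim t
      by (simp add: add.commute norm_minus_commute)
  qed
  then show False
    using \<open>A \<noteq> B\<close> by (simp add: a b ucoset_eq_iff_tendsto)
qed

lemma mlur_of_extreme_point_canonical_incl:
  fixes x :: "'a::real_normed_vector"
  assumes U: "free_ultrafilter U" and x: "x \<in> sphere 0 1"
    and ext: "extreme_point (ultrapower U) (unit_ball (ultrapower U)) (canonical_incl U x)"
  shows "mlur_point x"
  unfolding mlur_point_def
proof (intro conjI allI impI x; elim conjE)
  let ?W = "ultrapower U :: (nat \<Rightarrow>\<^sub>C 'a) set nvs"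
  fix y z :: "nat \<Rightarrow> 'a"
  assume y: "range y \<subseteq> sphere 0 1" and z: "range z \<subseteq> sphere 0 1"
    and m: "(\<lambda>n. norm (midpoint (y n) (z n) - x)) \<longlonglongrightarrow> 0"
  show "(\<lambda>n. norm (y n - z n)) \<longlonglongrightarrow> 0"
  proof (rule ccontr)
    assume "\<not> ?thesis"
    then obtain e where "e > 0" and "\<exists>\<^sub>F n in sequentially. \<not> norm (y n - z n) < e"
      by (auto simp: tendsto_iff frequently_def)
    then have "infinite {n. e \<le> norm (y n - z n)}"
      by (simp add: cofinite_eq_sequentially[symmetric] frequently_cofinite not_less)
    \<comment> \<open>The set of indices where \<open>y n\<close> and \<open>z n\<close> are
      \<open>e\<close> apart is infinite but may fail to belong to \<open>U\<close>. Along
      \<open>r\<close> they are apart at every index, which survives the limit along any free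
      ultrafilter.\<close>
    then obtain r :: "nat \<Rightarrow> nat" where r: "strict_mono r" "\<And>n. e \<le> norm (y (r n) - z (r n))"
      using infinite_enumerate by blast
    define a where "a = Bcontfun (\<lambda>n. y (r n))"
    define b where "b = Bcontfun (\<lambda>n. z (r n))"
    have y1: "norm (y n) = 1" and z1: "norm (z n) = 1" for n
      using y z by (auto simp: image_subset_iff)
    have a: "apply_bcontfun a = (\<lambda>n. y (r n))" and b: "apply_bcontfun b = (\<lambda>n. z (r n))"
      unfolding a_def b_def by (rule apply_bcontfun_Bcontfun[where b=1]; simp add: y1 z1)+
    have ball: "ucoset U a \<in> unit_ball ?W" "ucoset U b \<in> unit_ball ?W"
      using nrm_ultrapower[OF free_ultrafilter_neq_bot[OF U], of a 1]
        nrm_ultrapower[OF free_ultrafilter_neq_bot[OF U], of b 1]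
      by (simp_all add: unit_ball_def carrier_ultrapower a b y1 z1)
    have "ucoset U a \<noteq> ucoset U b"
    proof
      assume "ucoset U a = ucoset U b"
      then have "((\<lambda>n. norm (y (r n) - z (r n))) \<longlongrightarrow> 0) U"
        by (simp add: ucoset_eq_iff_tendsto a b)
      then have "e \<le> 0"
        by (rule tendsto_lowerbound) (simp_all add: r free_ultrafilter_neq_bot[OF U])
      with \<open>e > 0\<close> show False by simp
    qed
    moreover have "canonical_incl U x
        = add ?W (smul ?W (1 - 1/2) (ucoset U a)) (smul ?W (1/2) (ucoset U b))"
    proof -
      have "(\<lambda>n. norm (midpoint (y (r n)) (z (r n)) - x)) \<longlonglongrightarrow> 0"
        using LIMSEQ_subseq_LIMSEQ[OF m r(1)] by (simp add: o_def)
      then have "((\<lambda>n. norm (midpoint (y (r n)) (z (r n)) - x)) \<longlongrightarrow> 0) U"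
        using free_ultrafilter_le_sequentially[OF U] by (rule tendsto_mono[rotated])
      then show ?thesis
        by (simp add: canonical_incl_def add_ultrapower smul_ultrapower ucoset_eq_iff_tendsto
            const_bcontfun.rep_eq a b midpoint_def norm_minus_commute scaleR_add_right)
    qed
    moreover have "(0::real) < 1/2" "(1/2::real) < 1"
      by simp_all
    ultimately show False
      using ext ball unfolding extreme_point_def by blast
  qed
qed

section \<open>Smooth points\<close>

text \<open>By convexity the remainder \<open>norm (x + h) - norm x - g h\<close> is nonnegative,
  for \<open>h\<close> and for \<open>- h\<close>. The two remainders add up to the symmetric second
  difference, so a bound on the latter bounds each of them.\<close>

lemma has_derivative_norm_of_symmetric:
  fixes x :: "'a::real_normed_vector"
  assumes g: "bounded_linear g"
    and gateaux: "\<And>h. ((\<lambda>t. (norm (x + t *\<^sub>R h) - norm x) / t) \<longlongrightarrow> g h) (at 0)"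
    and sym: "\<And>e. e > 0 \<Longrightarrow> \<exists>d>0. \<forall>h. norm h < d \<longrightarrow>
      norm (x + h) + norm (x - h) - 2 * norm x \<le> e * norm h"
  shows "(norm has_derivative g) (at x)"
proof -
  \<comment> \<open>\<open>g\<close> is a subgradient: convexity bounds the quotient at
    \<open>t\<close> between 0 and 1 by the quotient at 1.\<close>
  have below: "g h \<le> norm (x + h) - norm x" for h
  proof (rule tendsto_upperbound[of _ _ "at_right 0"])
    show "((\<lambda>t. (norm (x + t *\<^sub>R h) - norm x) / t) \<longlongrightarrow> g h) (at_right 0)"
      using gateaux by (rule tendsto_within_subset) simp
    show "\<forall>\<^sub>F t in at_right 0. (norm (x + t *\<^sub>R h) - norm x) / t \<le> norm (x + h) - norm x"
      using eventually_at_right_less[of "0::real"] eventually_at_right_real[of 0 1, simplified]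
    proof eventually_elim
      case (elim t)
      have "x + t *\<^sub>R h = (1 - t) *\<^sub>R x + t *\<^sub>R (x + h)"
        by (simp add: algebra_simps)
      then have "norm (x + t *\<^sub>R h) \<le> (1 - t) * norm x + t * norm (x + h)"
        using elim norm_triangle_ineq[of "(1 - t) *\<^sub>R x" "t *\<^sub>R (x + h)"] by simp
      then show ?case
        using elim by (simp add: field_simps)
    qed
  qed simp
  show ?thesis
    unfolding has_derivative_at_alt
  proof (intro conjI g allI impI)
    fix e :: real assume "e > 0"
    then obtain d where "d > 0" and d: "\<And>h. norm h < d \<Longrightarrow>
        norm (x + h) + norm (x - h) - 2 * norm x \<le> e * norm h"
      using sym by blast
    have "norm (norm y - norm x - g (y - x)) \<le> e * norm (y - x)" if "norm (y - x) < d" for y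
      using below[of "y - x"] below[of "x - y"] d[OF that]
        linear_neg[OF bounded_linear.linear[OF g], of "y - x"]
      by (simp add: algebra_simps)
    then show "\<exists>d>0. \<forall>y. norm (y - x) < d \<longrightarrow>
        norm (norm y - norm x - g (y - x)) \<le> e * norm (y - x)"
      using \<open>d > 0\<close> by blast
  qed
qed

text \<open>Convexity of the norm on the segments from \<open>x\<close> to
  \<open>x + t *\<^sub>R u\<close> and \<open>x - t *\<^sub>R u\<close>. It allows steps of varying
  small length to be compared with one fixed step \<open>t\<close>.\<close>

lemma symmetric_difference_mono:
  fixes x :: "'a::real_normed_vector"
  assumes "0 \<le> s" "s \<le> t" "0 < t"
  shows "norm (x + s *\<^sub>R u) + norm (x - s *\<^sub>R u) - 2 * norm x
    \<le> s / t * (norm (x + t *\<^sub>R u) + norm (x - t *\<^sub>R u) - 2 * norm x)"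
proof -
  have *: "norm (x + s *\<^sub>R v) \<le> (1 - s / t) * norm x + s / t * norm (x + t *\<^sub>R v)" for v
  proof -
    have "x + s *\<^sub>R v = (1 - s / t) *\<^sub>R x + (s / t) *\<^sub>R (x + t *\<^sub>R v)"
      using assms by (simp add: algebra_simps)
    then show ?thesis
      using norm_triangle_ineq[of "(1 - s / t) *\<^sub>R x" "(s / t) *\<^sub>R (x + t *\<^sub>R v)"] assms
      by simp
  qed
  define q where "q = s / t"
  have "norm (x + s *\<^sub>R u) \<le> (1 - q) * norm x + q * norm (x + t *\<^sub>R u)"
    "norm (x - s *\<^sub>R u) \<le> (1 - q) * norm x + q * norm (x - t *\<^sub>R u)"
    using *[of u] *[of "- u"] by (simp_all add: q_def)
  then show ?thesis
    unfolding q_def[symmetric] left_diff_distrib right_diff_distrib distrib_left by linarith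
qed

lemma frechet_smooth_of_gateaux_smooth_canonical_incl:
  fixes x :: "'a::real_normed_vector"
  assumes U: "free_ultrafilter U" and x: "x \<in> sphere 0 1"
    and gs: "gateaux_smooth_point (ultrapower U) (canonical_incl U x)"
  shows "frechet_smooth_point x"
proof -
  let ?W = "ultrapower U :: (nat \<Rightarrow>\<^sub>C 'a) set nvs"
  let ?N = "\<lambda>t s. nrm ?W (add ?W (canonical_incl U x) (smul ?W t (ucoset U s)))"
  have x1: "norm x = 1"
    using x by simp
  obtain f where f: "f \<in> carrier (dual_space ?W)"
    and "\<forall>h\<in>carrier ?W.
      ((\<lambda>t. (nrm ?W (add ?W (canonical_incl U x) (smul ?W t h)) - nrm ?W (canonical_incl U x)) / t)
        \<longlongrightarrow> f h) (at 0)"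
    using gs by (auto simp: gateaux_smooth_point_def)
  then have der: "((\<lambda>t. (?N t s - 1) / t) \<longlongrightarrow> f (ucoset U s)) (at 0)" for s
    by (simp add: carrier_ultrapower nrm_canonical_incl[OF U] x1)
  \<comment> \<open>The candidate for the Frechet derivative is the restriction of the Gateaux
    derivative to the canonical copy of the space.\<close>
  define g where "g = (\<lambda>h. f (canonical_incl U h))"
  have lin: "linear_map_on ?W (carrier ?W) f"
    using f by (simp add: dual_space_def)
  obtain K where K: "\<And>u. u \<in> carrier ?W \<Longrightarrow> \<bar>f u\<bar> \<le> K * nrm ?W u"
    using f by (auto simp: dual_space_def)
  have "bounded_linear g"
  proof (rule bounded_linear_intro[where K=K])
    show "g (h + k) = g h + g k" for h k
    proof -
      have "const_bcontfun (h + k) = (const_bcontfun h + const_bcontfun k :: nat \<Rightarrow>\<^sub>C 'a)"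
        by (rule bcontfun_eqI) (simp add: const_bcontfun.rep_eq)
      then show ?thesis
        using lin unfolding linear_map_on_def g_def canonical_incl_def carrier_ultrapower
        by (metis add_ultrapower rangeI)
    qed
    show "g (r *\<^sub>R h) = r *\<^sub>R g h" for r h
    proof -
      have "const_bcontfun (r *\<^sub>R h) = (r *\<^sub>R const_bcontfun h :: nat \<Rightarrow>\<^sub>C 'a)"
        by (rule bcontfun_eqI) (simp add: const_bcontfun.rep_eq)
      then show ?thesis
        using lin unfolding linear_map_on_def g_def canonical_incl_def carrier_ultrapower
        by (metis smul_ultrapower rangeI)
    qed
    show "norm (g h) \<le> norm h * K" for h
      using K[of "canonical_incl U h"] nrm_canonical_incl[OF U, of h]
      by (simp add: g_def canonical_incl_def carrier_ultrapower mult.commute)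
  qed
  moreover have "((\<lambda>t. (norm (x + t *\<^sub>R h) - norm x) / t) \<longlongrightarrow> g h) (at 0)" for h
  proof -
    have "?N t (const_bcontfun h) = norm (x + t *\<^sub>R h)" for t
      using tendsto_nrm_translate[OF U, of x t "const_bcontfun h"]
        tendsto_unique[OF free_ultrafilter_neq_bot[OF U]]
      by (simp add: const_bcontfun.rep_eq) (use tendsto_const in blast)
    then show ?thesis
      using der[of "const_bcontfun h"] by (simp add: g_def canonical_incl_def x1)
  qed
  moreover have "\<exists>d>0. \<forall>h. norm h < d \<longrightarrow>
      norm (x + h) + norm (x - h) - 2 * norm x \<le> e * norm h" if "e > 0" for e
  proof (rule ccontr)
    \<comment> \<open>Failure of uniformity yields vectors \<open>h n\<close> tending to 0 with
      large second differences. Their normalisations form a single direction in the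
      ultrapower.\<close>
    assume "\<not> ?thesis"
    then have "\<forall>n. \<exists>h. norm h < inverse (real (Suc n)) \<and>
        e * norm h < norm (x + h) + norm (x - h) - 2 * norm x"
      by (metis not_le inverse_positive_iff_positive of_nat_0_less_iff zero_less_Suc)
    then obtain h where h0: "\<And>n. norm (h n) < inverse (real (Suc n))"
      and h: "\<And>n. e * norm (h n) < norm (x + h n) + norm (x - h n) - 2 * norm x"
      by metis
    define s where "s = Bcontfun (\<lambda>n. sgn (h n))"
    have s: "apply_bcontfun s = (\<lambda>n. sgn (h n))"
      unfolding s_def by (rule apply_bcontfun_Bcontfun[where b=1]) (simp add: norm_sgn)
    \<comment> \<open>Quotients at \<open>t\<close> and \<open>- t\<close> have the same limit.
      Subtracting them shows that the second difference in direction \<open>s\<close> is of smaller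
      order than \<open>t\<close>.\<close>
    have "filterlim (\<lambda>t::real. - t) (at 0) (at_right 0)"
      by (rule filterlim_atI) (auto intro!: tendsto_eq_intros eventually_at_right_less
          simp: eventually_at_filter)
    from filterlim_compose[OF der this]
    have "((\<lambda>t. (?N (- t) s - 1) / (- t)) \<longlongrightarrow> f (ucoset U s)) (at_right 0)" .
    moreover have "((\<lambda>t. (?N t s - 1) / t) \<longlongrightarrow> f (ucoset U s)) (at_right 0)"
      using der by (rule tendsto_within_subset) simp
    ultimately have "((\<lambda>t. (?N t s - 1) / t - (?N (- t) s - 1) / (- t)) \<longlongrightarrow> 0) (at_right 0)"
      using tendsto_diff by fastforce
    then have "\<forall>\<^sub>F t in at_right 0. (?N t s - 1) / t - (?N (- t) s - 1) / (- t) < e"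
      using \<open>e > 0\<close> by (rule order_tendstoD)
    with eventually_at_right_less[of "0::real"]
    have "\<forall>\<^sub>F t in at_right 0. 0 < t \<and> ?N t s + ?N (- t) s - 2 < e * t"
    proof eventually_elim
      case (elim t)
      then have "(?N t s + ?N (- t) s - 2) / t < e"
        by (simp add: add_divide_distrib diff_divide_distrib)
      then show ?case
        using elim(1) by (simp add: pos_divide_less_eq)
    qed
    then obtain t where "t > 0" and t: "?N t s + ?N (- t) s - 2 < e * t"
      using eventually_happens'[OF trivial_limit_at_right_real] by blast
    \<comment> \<open>With \<open>t\<close> now fixed, the strict inequality in the ultrapower
      passes back to the terms for \<open>U\<close>-almost all \<open>n\<close>.\<close>
    have "((\<lambda>n. norm (x + t *\<^sub>R s n) + norm (x + (- t) *\<^sub>R s n) - 2) \<longlongrightarrow>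
        ?N t s + ?N (- t) s - 2) U"
      by (intro tendsto_intros tendsto_nrm_translate[OF U])
    then have "\<forall>\<^sub>F n in U. norm (x + t *\<^sub>R s n) + norm (x + (- t) *\<^sub>R s n) - 2 < e * t"
      using t by (rule order_tendstoD)
    \<comment> \<open>This makes \<open>h n\<close> shorter than \<open>t\<close>, as
      \<open>symmetric_difference_mono\<close> requires for going from step \<open>t\<close> down to
      \<open>h n\<close>.\<close>
    moreover have "\<forall>\<^sub>F n in U. inverse (real (Suc n)) < t"
      using filter_leD[OF free_ultrafilter_le_sequentially[OF U]]
        order_tendstoD(2)[OF LIMSEQ_inverse_real_of_nat \<open>t > 0\<close>] by blast
    ultimately have "\<forall>\<^sub>F n in U. norm (x + t *\<^sub>R s n) + norm (x + (- t) *\<^sub>R s n) - 2 < e * t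
        \<and> inverse (real (Suc n)) < t"
      by (rule eventually_conj)
    then obtain n where n: "norm (x + t *\<^sub>R sgn (h n)) + norm (x - t *\<^sub>R sgn (h n)) - 2 < e * t"
      and nt: "inverse (real (Suc n)) < t"
      using eventually_happens'[OF free_ultrafilter_neq_bot[OF U]] by (auto simp: s)
    have "h n \<noteq> 0"
      using h[of n] by auto
    have hn: "norm (h n) *\<^sub>R sgn (h n) = h n"
      using \<open>h n \<noteq> 0\<close> by (simp add: sgn_div_norm)
    have "norm (x + h n) + norm (x - h n) - 2 * norm x
        \<le> norm (h n) / t * (norm (x + t *\<^sub>R sgn (h n)) + norm (x - t *\<^sub>R sgn (h n)) - 2 * norm x)"
      using symmetric_difference_mono[of "norm (h n)" t x "sgn (h n)"] h0[of n] nt \<open>t > 0\<close>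
      by (simp add: hn)
    also have "\<dots> \<le> norm (h n) / t * (e * t)"
      using n \<open>t > 0\<close> x1 by (intro mult_left_mono) auto
    also have "\<dots> = e * norm (h n)"
      using \<open>t > 0\<close> by simp
    finally show False
      using h[of n] by simp
  qed
  ultimately have "(norm has_derivative g) (at x)"
    by (rule has_derivative_norm_of_symmetric)
  then show ?thesis
    using x by (auto simp: frechet_smooth_point_def differentiable_def)
qed

text \<open>The derivative at the canonical image of \<open>x\<close> is the limit along
  \<open>U\<close> of \<open>g\<close> applied to the terms of a representative.\<close>

lemma gateaux_smooth_canonical_incl_of_frechet_smooth:
  fixes x :: "'a::real_normed_vector"
  assumes U: "free_ultrafilter U" and fr: "frechet_smooth_point x"
  shows "gateaux_smooth_point (ultrapower U) (canonical_incl U x)"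
proof -
  let ?W = "ultrapower U :: (nat \<Rightarrow>\<^sub>C 'a) set nvs"
  note nb = free_ultrafilter_neq_bot[OF U]
  obtain g where g: "(norm has_derivative g) (at x)" and x1: "norm x = 1"
    using fr by (auto simp: frechet_smooth_point_def differentiable_def)
  have bl: "bounded_linear g"
    using g by (rule has_derivative_bounded_linear)
  \<comment> \<open>A representative is chosen arbitrarily; \<open>fI\<close> shows independence of
    the choice, as \<open>g\<close> maps null sequences to null sequences. The value 0 off the
    carrier is the normalisation in \<open>dual_space\<close>.\<close>
  define f where "f = (\<lambda>C. if C \<in> carrier ?W
    then Lim U (\<lambda>n. g (apply_bcontfun (SOME s. C = ucoset U s) n)) else 0)"
  have fI: "f (ucoset U s) = l" if l: "((\<lambda>n. g (s n)) \<longlongrightarrow> l) U" for s :: "nat \<Rightarrow>\<^sub>C 'a" and l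
  proof -
    define r where "r = (SOME r. ucoset U s = ucoset U r)"
    have "ucoset U s = ucoset U r"
      unfolding r_def by (rule someI) simp
    then have "((\<lambda>n. r n - s n) \<longlongrightarrow> 0) U"
      using ucoset_eq_iff_tendsto[of U r s] by (simp add: tendsto_norm_zero_iff)
    from bounded_linear.tendsto_zero[OF bl this] have "((\<lambda>n. g (s n) + g (r n - s n)) \<longlongrightarrow> l + 0) U"
      by (intro tendsto_add l)
    moreover have "g (s n) + g (r n - s n) = g (r n)" for n
      using bounded_linear.linear[OF bl] by (simp add: linear_diff)
    ultimately have "Lim U (\<lambda>n. g (r n)) = l"
      using nb by (intro tendsto_Lim) simp_all
    then show ?thesis
      by (simp add: f_def carrier_ultrapower r_def)
  qed
  have f: "((\<lambda>n. g (s n)) \<longlongrightarrow> f (ucoset U s)) U" for s :: "nat \<Rightarrow>\<^sub>C 'a"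
  proof -
    have "bounded (range (\<lambda>n. g (apply_bcontfun s n)))"
      using bounded_linear_image[OF bounded_range_apply_bcontfun bl] by (simp add: image_image)
    then obtain l where "((\<lambda>n. g (s n)) \<longlongrightarrow> l) U"
      by (rule free_ultrafilter_bounded_convergent[OF U])
    then show ?thesis
      using fI by simp
  qed
  have "linear_map_on ?W (carrier ?W) f"
    unfolding linear_map_on_def carrier_ultrapower
  proof (safe; unfold add_ultrapower smul_ultrapower)
    show "f (ucoset U (s + t)) = f (ucoset U s) + f (ucoset U t)" for s t
      by (rule fI) (simp add: linear_add[OF bounded_linear.linear[OF bl]] tendsto_add f)
    show "f (ucoset U (r *\<^sub>R s)) = r *\<^sub>R f (ucoset U s)" for r s
      by (rule fI) (simp add: linear_cmul[OF bounded_linear.linear[OF bl]] tendsto_mult f)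
  qed
  moreover have "\<exists>K. \<forall>u\<in>carrier ?W. \<bar>f u\<bar> \<le> K * nrm ?W u"
  proof (intro exI ballI)
    fix u assume "u \<in> carrier ?W"
    then obtain s where u: "u = ucoset U s"
      by (auto simp: carrier_ultrapower)
    show "\<bar>f u\<bar> \<le> onorm g * nrm ?W u"
      unfolding u
    proof (rule tendsto_le[OF nb])
      show "((\<lambda>n. onorm g * norm (s n)) \<longlongrightarrow> onorm g * nrm ?W (ucoset U s)) U"
        by (intro tendsto_intros tendsto_nrm_ultrapower[OF U])
      show "((\<lambda>n. \<bar>g (s n)\<bar>) \<longlongrightarrow> \<bar>f (ucoset U s)\<bar>) U"
        by (intro tendsto_intros f)
      show "\<forall>\<^sub>F n in U. \<bar>g (s n)\<bar> \<le> onorm g * norm (s n)"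
        using onorm[OF bl] by simp
    qed
  qed
  ultimately have "f \<in> carrier (dual_space ?W)"
    by (simp add: dual_space_def f_def)
  moreover have "((\<lambda>t. (nrm ?W (add ?W (canonical_incl U x) (smul ?W t h))
      - nrm ?W (canonical_incl U x)) / t) \<longlongrightarrow> f h) (at 0)" if "h \<in> carrier ?W" for h
  proof -
    obtain s where h: "h = ucoset U s"
      using \<open>h \<in> carrier ?W\<close> by (auto simp: carrier_ultrapower)
    \<comment> \<open>The summand 1 makes \<open>M\<close> positive also when \<open>s\<close> is
      zero, so that division by \<open>M\<close> is possible.\<close>
    define M where "M = norm s + 1"
    have M: "M > 0" "norm (s n) \<le> M" for n
      using norm_bounded[of s n] norm_ge_zero[of s] unfolding M_def by linarith+
    let ?N = "\<lambda>t. nrm ?W (add ?W (canonical_incl U x) (smul ?W t h))"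
    have "((\<lambda>t. (?N t - 1) / t) \<longlongrightarrow> f h) (at 0)"
    proof (rule metric_LIM_I)
      fix e :: real assume "e > 0"
      \<comment> \<open>The factor 2 makes the final estimate strict after the limit along
        \<open>U\<close> has left only a weak inequality.\<close>
      define e' where "e' = e / (2 * M)"
      have "e' > 0"
        using \<open>e > 0\<close> M by (simp add: e'_def)
      then obtain d where "d > 0" and d: "\<And>y. norm (y - x) < d \<Longrightarrow>
          norm (norm y - norm x - g (y - x)) \<le> e' * norm (y - x)"
        using g unfolding has_derivative_at_alt by blast
      show "\<exists>d>0. \<forall>t. t \<noteq> 0 \<and> dist t 0 < d \<longrightarrow> dist ((?N t - 1) / t) (f h) < e"
      \<comment> \<open>For \<open>t\<close> below \<open>d / M\<close> all increments
        \<open>t *\<^sub>R s n\<close> have norm less than \<open>d\<close> at once.\<close>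
      proof (intro exI[of _ "d / M"] conjI allI impI)
        show "d / M > 0"
          using \<open>d > 0\<close> M by simp
        fix t :: real assume t: "t \<noteq> 0 \<and> dist t 0 < d / M"
        have "\<bar>norm (x + t *\<^sub>R s n) - 1 - t * g (s n)\<bar> \<le> e' * (\<bar>t\<bar> * M)" for n
        proof -
          have le: "norm (t *\<^sub>R s n) \<le> \<bar>t\<bar> * M"
            using M by (simp add: mult_left_mono)
          also have "\<dots> < d"
            using t M by (simp add: field_simps)
          finally have "\<bar>norm (x + t *\<^sub>R s n) - 1 - t * g (s n)\<bar> \<le> e' * norm (t *\<^sub>R s n)"
            using d[of "x + t *\<^sub>R s n"] x1
            by (simp add: linear_cmul[OF bounded_linear.linear[OF bl]])
          also have "\<dots> \<le> e' * (\<bar>t\<bar> * M)"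
            using le \<open>e' > 0\<close> by (intro mult_left_mono) auto
          finally show ?thesis .
        qed
        then have "\<forall>\<^sub>F n in U. \<bar>norm (x + t *\<^sub>R s n) - 1 - t * g (s n)\<bar> \<le> e' * (\<bar>t\<bar> * M)"
          by simp
        moreover have "((\<lambda>n. \<bar>norm (x + t *\<^sub>R s n) - 1 - t * g (s n)\<bar>) \<longlongrightarrow>
            \<bar>?N t - 1 - t * f h\<bar>) U"
          unfolding h by (intro tendsto_intros tendsto_nrm_translate[OF U] f)
        ultimately have "\<bar>?N t - 1 - t * f h\<bar> \<le> e' * (\<bar>t\<bar> * M)"
          by (rule tendsto_upperbound[OF _ _ nb, rotated])
        also have "\<dots> < \<bar>t\<bar> * e"
          using t \<open>e > 0\<close> M by (simp add: e'_def)
        finally have "\<bar>?N t - 1 - t * f h\<bar> / \<bar>t\<bar> < e"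
          using t by (simp add: field_simps)
        moreover have "(?N t - 1) / t - f h = (?N t - 1 - t * f h) / t"
          using t by (simp add: field_simps)
        ultimately show "dist ((?N t - 1) / t) (f h) < e"
          by (simp add: dist_real_def abs_divide)
      qed
    qed
    then show ?thesis
      by (simp add: nrm_canonical_incl[OF U] x1)
  qed
  moreover have "canonical_incl U x \<in> unit_sphere ?W"
    using nrm_canonical_incl[OF U, of x] x1
    by (simp add: unit_sphere_def carrier_ultrapower) (simp add: canonical_incl_def)
  ultimately show ?thesis
    unfolding gateaux_smooth_point_def by blast
qed

theorem theorem2p1:
  fixes x :: "'a::banach" and U :: "nat filter"
  assumes "free_ultrafilter U" and "x \<in> sphere 0 1"
  shows "(mlur_point x \<longleftrightarrow>
            extreme_point (ultrapower U) (unit_ball (ultrapower U)) (canonical_incl U x))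
       \<and> (gateaux_smooth_point (ultrapower U) (canonical_incl U x) \<longrightarrow> frechet_smooth_point x)
       \<and> (superreflexive TYPE('a) \<longrightarrow> frechet_smooth_point x \<longrightarrow>
            gateaux_smooth_point (ultrapower U) (canonical_incl U x))
       \<and> (\<forall>V. free_ultrafilter V \<longrightarrow>
            (extreme_point (ultrapower U) (unit_ball (ultrapower U)) (canonical_incl U x) \<longleftrightarrow>
             extreme_point (ultrapower V) (unit_ball (ultrapower V)) (canonical_incl V x)))"
  \<comment> \<open>Independence of the ultrafilter follows from the first claim for
    \<open>U\<close> and for \<open>V\<close>, since MLUR does not mention an ultrafilter.\<close>
  using assms extreme_point_canonical_incl_of_mlur mlur_of_extreme_point_canonical_incl
    frechet_smooth_of_gateaux_smooth_canonical_incl gateaux_smooth_canonical_incl_of_frechet_smooth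
  by blast

end
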